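(* Let $K$ be a field. The set of finite simple graphs $G$ such that the toric ring $R_G$ is strongly Koszul is closed under the $0$-sum; that is, if $R_{G_1}$ and $R_{G_2}$ are strongly Koszul and $G_1\# G_2$ is a $0$-sum of $G_1$ and $G_2$, then $R_{G_1\# G_2}$ is strongly Koszul.
   Context: Let $G$ be a finite simple graph with vertex set $V(G)$ and edge set $E(G)$. For each unordered partition $A|B$ of $V(G)$ (that is, $A\cap B=\emptyset$, $A\cup B=V(G)$, possibly with $A$ or $B$ empty, and $A|B=B|A$) take a variable $q_{A|B}$, and let $K[q]$ be the polynomial ring over $K$ in these $2^{|V(G)|-1}$ variables. Let $K[s,T]=K[s,t_{ij}\mid ij\in E(G)]$. Define the $K$-algebra homomorphism $\pi_G:K[q]\to K[s,T]$ by $\pi_G(q_{A|B})=u_{A|B}:=s\cdot\prod_{ij\in E(G),\ |A\cap\{i,j\}|=1}t_{ij}$. The toric ring $R_G$ (of the cut ideal $I_G=\ker\pi_G$) is the image of $\pi_G$, i.e. the $K$-subalgebra of $K[s,T]$ generated by the monomials $u_{A|B}$, graded so that each $u_{A|B}$ has degree $1$ (degree in $s$). A semigroup ring $R$ generated by (distinct) monomials $u_1,\dots,u_n$, each of degree $1$, is called strongly Koszul if for all $i\neq j$ the ideal $(u_i)\cap(u_j)$ of $R$ is generated in degree $2$. Let $G_1=(V_1,E_1)$ and $G_2=(V_2,E_2)$ be simple graphs such that $V_1\cap V_2$ is a clique of both graphs. The graph $G_1\# G_2$ with vertex set $V_1\cup V_2$ and edge set $E_1\cup E_2$ is called the clique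 sum of $G_1$ and $G_2$ along $V_1\cap V_2$. If $|V_1\cap V_2|=k+1$, it is called a $k$-sum; thus a $0$-sum glues the two graphs at a single common vertex. *)

theory Defs
  imports "HOL.Hull" "HOL-Library.Poly_Mapping" "HOL-Algebra.Ideal"
begin

section \<open>Multivariate polynomials\<close>

text \<open>
  Polynomials over \<open>'k\<close> in variables \<open>'x\<close> are finitely supported maps from exponent
  vectors to coefficients; \<open>Poly_Mapping\<close> provides their ring structure (convolution).
\<close>

type_synonym ('x, 'k) mpoly = "('x \<Rightarrow>\<^sub>0 nat) \<Rightarrow>\<^sub>0 'k"

definition mconst :: "'k::comm_ring_1 \<Rightarrow> ('x, 'k) mpoly"
  where "mconst c = Poly_Mapping.single 0 c"

definition mvar :: "'x \<Rightarrow> ('x, 'k::comm_ring_1) mpoly"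
  where "mvar x = Poly_Mapping.single (Poly_Mapping.single x 1) 1"

definition mpolys_over :: "'x set \<Rightarrow> ('x, 'k::comm_ring_1) mpoly set"
  where "mpolys_over X = {p. \<forall>m \<in> Poly_Mapping.keys p. Poly_Mapping.keys m \<subseteq> X}"

text \<open>The \<open>'k\<close>-algebra homomorphism that sends each variable \<open>x\<close> to \<open>f x\<close>.\<close>

definition msubst :: "('x \<Rightarrow> ('y, 'k) mpoly) \<Rightarrow> ('x, 'k::comm_ring_1) mpoly \<Rightarrow> ('y, 'k) mpoly"
  where "msubst f p =
    (\<Sum>m \<in> Poly_Mapping.keys p.
       mconst (Poly_Mapping.lookup p m) *
       (\<Prod>x \<in> Poly_Mapping.keys m. f x ^ Poly_Mapping.lookup m x))"

definition subalg :: "('x, 'k::comm_ring_1) mpoly set \<Rightarrow> bool"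
  where "subalg A \<longleftrightarrow> (\<forall>c. mconst c \<in> A) \<and>
    (\<forall>p \<in> A. \<forall>q \<in> A. p + q \<in> A) \<and> (\<forall>p \<in> A. \<forall>q \<in> A. p * q \<in> A)"

definition mring :: "('x, 'k::comm_ring_1) mpoly set \<Rightarrow> ('x, 'k) mpoly ring"
  where "mring A = \<lparr>carrier = A, monoid.mult = (*), one = 1, zero = 0, add = (+)\<rparr>"


section \<open>Strongly Koszul semigroup rings\<close>

text \<open>
  The grading of a subring of a polynomial ring is given by a degree function \<open>deg\<close> on
  exponent vectors.
\<close>

definition homogeneous :: "(('x \<Rightarrow>\<^sub>0 nat) \<Rightarrow> nat) \<Rightarrow> nat \<Rightarrow> ('x, 'k::comm_ring_1) mpoly \<Rightarrow> bool"
  where "homogeneous deg d p \<longleftrightarrow> (\<forall>m \<in> Poly_Mapping.keys p. deg m = d)"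

definition generated_in_degree ::
    "(('x \<Rightarrow>\<^sub>0 nat) \<Rightarrow> nat) \<Rightarrow> ('x, 'k::comm_ring_1) mpoly ring \<Rightarrow> nat \<Rightarrow> ('x, 'k) mpoly set \<Rightarrow> bool"
  where "generated_in_degree deg R d I \<longleftrightarrow>
    (\<exists>B \<subseteq> carrier R. (\<forall>b \<in> B. homogeneous deg d b) \<and> I = Idl\<^bsub>R\<^esub> B)"

text \<open>
  \<open>U\<close> is the set of monomial generators of the semigroup ring \<open>R\<close>; as it is a set, the
  condition ranges over pairs of distinct monomials, also when \<open>U\<close> comes from a family with
  repetitions.
\<close>

definition strongly_Koszul ::
    "(('x \<Rightarrow>\<^sub>0 nat) \<Rightarrow> nat) \<Rightarrow> ('x, 'k::comm_ring_1) mpoly ring \<Rightarrow> ('x, 'k) mpoly set \<Rightarrow> bool"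
  where "strongly_Koszul deg R U \<longleftrightarrow>
    (\<forall>u \<in> U. \<forall>v \<in> U. u \<noteq> v \<longrightarrow> generated_in_degree deg R 2 (PIdl\<^bsub>R\<^esub> u \<inter> PIdl\<^bsub>R\<^esub> v))"


section \<open>Graphs and clique sums\<close>

record 'v graph =
  verts :: "'v set"
  edges :: "'v set set"

definition finite_simple_graph :: "'v graph \<Rightarrow> bool"
  where "finite_simple_graph G \<longleftrightarrow>
    finite (verts G) \<and> (\<forall>e \<in> edges G. e \<subseteq> verts G \<and> card e = 2)"

definition clique :: "'v graph \<Rightarrow> 'v set \<Rightarrow> bool"
  where "clique G W \<longleftrightarrow> W \<subseteq> verts G \<and> (\<forall>x \<in> W. \<forall>y \<in> W. x \<noteq> y \<longrightarrow> {x, y} \<in> edges G)"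

definition clique_sum :: "'v graph \<Rightarrow> 'v graph \<Rightarrow> 'v graph"
  where "clique_sum G1 G2 = \<lparr>verts = verts G1 \<union> verts G2, edges = edges G1 \<union> edges G2\<rparr>"

definition is_k_sum :: "nat \<Rightarrow> 'v graph \<Rightarrow> 'v graph \<Rightarrow> 'v graph \<Rightarrow> bool"
  where "is_k_sum k G1 G2 G \<longleftrightarrow>
    clique G1 (verts G1 \<inter> verts G2) \<and> clique G2 (verts G1 \<inter> verts G2) \<and>
    card (verts G1 \<inter> verts G2) = k + 1 \<and> G = clique_sum G1 G2"


section \<open>Toric rings of cut ideals\<close>

text \<open>The unordered partition \<open>A|B\<close> is represented by the set \<open>{A, B}\<close>.\<close>

definition cut_partitions :: "'v graph \<Rightarrow> 'v set set set"
  where "cut_partitions G = {{A, B} | A B. A \<inter> B = {} \<and> A \<union> B = verts G}"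

datatype 'v cut_var = Svar | Tvar "'v set"

text \<open>
  The edges \<open>e\<close> with \<open>card (A \<inter> e) = 1\<close>. Since \<open>card e = 2\<close>, this is equivalent to
  \<open>card (B \<inter> e) = 1\<close>, so the side on which it is tested is irrelevant.
\<close>

definition cut_edges :: "'v graph \<Rightarrow> 'v set set \<Rightarrow> 'v set set"
  where "cut_edges G P = {e \<in> edges G. \<exists>A \<in> P. card (A \<inter> e) = 1}"

definition cut_monomial :: "'v graph \<Rightarrow> 'v set set \<Rightarrow> ('v cut_var, 'k::field) mpoly"
  where "cut_monomial G P = mvar Svar * (\<Prod>e \<in> cut_edges G P. mvar (Tvar e))"

definition cut_hom :: "'v graph \<Rightarrow> ('v set set, 'k::field) mpoly \<Rightarrow> ('v cut_var, 'k) mpoly"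
  where "cut_hom G = msubst (cut_monomial G)"

definition toric_ring :: "'v graph \<Rightarrow> ('v cut_var, 'k::field) mpoly ring"
  where "toric_ring G = mring (cut_hom G ` mpolys_over (cut_partitions G))"

definition cut_monomials :: "'v graph \<Rightarrow> ('v cut_var, 'k::field) mpoly set"
  where "cut_monomials G = cut_monomial G ` cut_partitions G"

definition s_degree :: "('v cut_var \<Rightarrow>\<^sub>0 nat) \<Rightarrow> nat"
  where "s_degree m = Poly_Mapping.lookup m Svar"

definition toric_strongly_Koszul :: "'k::field itself \<Rightarrow> 'v graph \<Rightarrow> bool"
  where "toric_strongly_Koszul K G \<longleftrightarrow>
    strongly_Koszul s_degree (toric_ring G :: ('v cut_var, 'k) mpoly ring) (cut_monomials G)"


section \<open>Basic facts\<close>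

lemma finite_simple_graph_clique_sum:
  assumes "finite_simple_graph G1" "finite_simple_graph G2"
  shows "finite_simple_graph (clique_sum G1 G2)"
  using assms by (auto simp: finite_simple_graph_def clique_sum_def)

lemma mconst_add: "mconst (a + b) = mconst a + mconst b"
  by (simp add: mconst_def single_add)

lemma mconst_mult: "mconst (a * b) = mconst a * mconst b"
  by (simp add: mconst_def mult_single)

lemma mconst_0 [simp]: "mconst 0 = 0"
  by (simp add: mconst_def)

lemma mconst_1 [simp]: "mconst 1 = 1"
  by (simp add: mconst_def)

lemma msubst_superset:
  assumes "finite A" "Poly_Mapping.keys p \<subseteq> A"
  shows "msubst f p = (\<Sum>m \<in> A. mconst (Poly_Mapping.lookup p m) *
           (\<Prod>x \<in> Poly_Mapping.keys m. f x ^ Poly_Mapping.lookup m x))"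
  unfolding msubst_def using assms
  by (intro sum.mono_neutral_left) (auto simp: in_keys_iff)

lemma msubst_add: "msubst f (p + q) = msubst f p + msubst f q"
proof -
  let ?A = "Poly_Mapping.keys p \<union> Poly_Mapping.keys q"
  have A: "finite ?A" "Poly_Mapping.keys p \<subseteq> ?A" "Poly_Mapping.keys q \<subseteq> ?A"
    "Poly_Mapping.keys (p + q) \<subseteq> ?A"
    using keys_add[of p q] by auto
  show ?thesis
    unfolding msubst_superset[OF A(1,2)] msubst_superset[OF A(1,3)] msubst_superset[OF A(1,4)]
    by (simp add: lookup_add mconst_add distrib_right sum.distrib)
qed

lemma msubst_single:
  "msubst f (Poly_Mapping.single m c) =
     mconst c * (\<Prod>x \<in> Poly_Mapping.keys m. f x ^ Poly_Mapping.lookup m x)"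
  by (subst msubst_superset[where A = "{m}"]) auto

lemma msubst_0 [simp]: "msubst f 0 = 0"
  by (simp add: msubst_def)

lemma msubst_mconst [simp]: "msubst f (mconst c) = mconst c"
  by (simp add: mconst_def msubst_single)

lemma msubst_mvar [simp]: "msubst f (mvar x) = f x"
  by (simp add: mvar_def msubst_single)

lemma msubst_sum: "msubst f (sum g A) = (\<Sum>a \<in> A. msubst f (g a))"
  by (induction A rule: infinite_finite_induct) (auto simp: msubst_add)

lemma mpoly_expand:
  "p = (\<Sum>m \<in> Poly_Mapping.keys p. Poly_Mapping.single m (Poly_Mapping.lookup p m))"
  by (rule poly_mapping_eqI)
     (auto simp: lookup_sum lookup_single when_def in_keys_iff sum.delta)

lemma exponent_prod_add:
  fixes f :: "'x \<Rightarrow> 'a::comm_monoid_mult"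
  shows "(\<Prod>x \<in> Poly_Mapping.keys (m + n). f x ^ Poly_Mapping.lookup (m + n) x) =
    (\<Prod>x \<in> Poly_Mapping.keys m. f x ^ Poly_Mapping.lookup m x) *
    (\<Prod>x \<in> Poly_Mapping.keys n. f x ^ Poly_Mapping.lookup n x)"
proof -
  let ?A = "Poly_Mapping.keys m \<union> Poly_Mapping.keys n"
  have sup: "(\<Prod>x \<in> Poly_Mapping.keys k. f x ^ Poly_Mapping.lookup k x) =
      (\<Prod>x \<in> ?A. f x ^ Poly_Mapping.lookup k x)" if "Poly_Mapping.keys k \<subseteq> ?A" for k
    using that by (intro prod.mono_neutral_left) (auto simp: in_keys_iff)
  have "Poly_Mapping.keys (m + n) \<subseteq> ?A"
    by (rule keys_add)
  then show ?thesis
    using sup[of m] sup[of n] sup[of "m + n"]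
    by (simp add: lookup_add power_add prod.distrib)
qed

lemma msubst_mult: "msubst f (p * q) = msubst f p * msubst f q"
proof -
  let ?P = "Poly_Mapping.keys p" and ?Q = "Poly_Mapping.keys q"
  let ?p = "Poly_Mapping.lookup p" and ?q = "Poly_Mapping.lookup q"
  have "p * q = (\<Sum>m \<in> ?P. Poly_Mapping.single m (?p m)) * (\<Sum>n \<in> ?Q. Poly_Mapping.single n (?q n))"
    using mpoly_expand[of p] mpoly_expand[of q] by simp
  also have "\<dots> = (\<Sum>m \<in> ?P. \<Sum>n \<in> ?Q. Poly_Mapping.single (m + n) (?p m * ?q n))"
    by (simp add: sum_product mult_single)
  finally have "msubst f (p * q) =
      (\<Sum>m \<in> ?P. \<Sum>n \<in> ?Q. msubst f (Poly_Mapping.single (m + n) (?p m * ?q n)))"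
    by (simp add: msubst_sum)
  also have "\<dots> = msubst f p * msubst f q"
    unfolding msubst_single exponent_prod_add mconst_mult
    by (simp add: msubst_def sum_product mult_ac)
  finally show ?thesis .
qed

lemma subalg_mpolys_over: "subalg (mpolys_over X)"
proof -
  have "p * q \<in> mpolys_over X"
    if p: "p \<in> mpolys_over X" and q: "q \<in> mpolys_over X" for p q :: "('a, 'b) mpoly"
    unfolding mpolys_over_def
  proof (intro CollectI ballI)
    fix k assume "k \<in> Poly_Mapping.keys (p * q)"
    then obtain m n where "k = m + n" "m \<in> Poly_Mapping.keys p" "n \<in> Poly_Mapping.keys q"
      using keys_mult[of p q] by blast
    then show "Poly_Mapping.keys k \<subseteq> X"
      using p q keys_add[of m n] unfolding mpolys_over_def by blast
  qed
  moreover have "p + q \<in> mpolys_over X"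
    if "p \<in> mpolys_over X" "q \<in> mpolys_over X" for p q :: "('a, 'b) mpoly"
    using that keys_add[of p q] unfolding mpolys_over_def by blast
  moreover have "mconst c \<in> mpolys_over X" for c :: 'b
    by (simp add: mpolys_over_def mconst_def)
  ultimately show ?thesis
    by (simp add: subalg_def)
qed

lemma cring_mring:
  assumes "subalg A"
  shows "cring (mring A)"
proof -
  have c: "mconst c \<in> A" for c
    using assms by (simp add: subalg_def)
  have add: "p + q \<in> A" and mult: "p * q \<in> A" if "p \<in> A" "q \<in> A" for p q
    using assms that by (simp_all add: subalg_def)
  have one: "1 \<in> A" and zero: "0 \<in> A"
    using c[of 1] c[of 0] by simp_all
  have minus: "- p \<in> A" if "p \<in> A" for p
  proof -
    have "mconst (- 1) * p = - p"
      by (simp add: mconst_def single_uminus)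
    then show ?thesis
      using mult[OF c[of "- 1"] that] by simp
  qed
  show ?thesis
  proof (rule cringI)
    show "abelian_group (mring A)"
      by (rule abelian_groupI)
         (auto simp: mring_def add zero add_ac intro: bexI[of _ "- x" for x] minus)
    show "comm_monoid (mring A)"
      by (rule comm_monoidI) (auto simp: mring_def mult one mult_ac)
  qed (auto simp: mring_def distrib_right)
qed

lemma subalg_image_msubst:
  assumes "subalg A"
  shows "subalg (msubst f ` A)"
proof -
  have c: "mconst c \<in> msubst f ` A" for c
    using assms by (intro image_eqI[of _ _ "mconst c"]) (simp_all add: subalg_def)
  have "p + q \<in> msubst f ` A \<and> p * q \<in> msubst f ` A"
    if p: "p \<in> msubst f ` A" and q: "q \<in> msubst f ` A" for p q
  proof -
    obtain p' q' where pq: "p' \<in> A" "q' \<in> A" "p = msubst f p'" "q = msubst f q'"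
      using p q by blast
    then have "p + q = msubst f (p' + q')" "p * q = msubst f (p' * q')"
      by (simp_all add: msubst_add msubst_mult)
    moreover have "p' + q' \<in> A" "p' * q' \<in> A"
      using assms pq by (simp_all add: subalg_def)
    ultimately show ?thesis
      by blast
  qed
  with c show ?thesis
    by (simp add: subalg_def)
qed

theorem cring_toric_ring: "cring (toric_ring G)"
  unfolding toric_ring_def cut_hom_def
  by (intro cring_mring subalg_image_msubst subalg_mpolys_over)

lemma msubst_image_eq_hull:
  fixes f :: "'x \<Rightarrow> ('y, 'k::comm_ring_1) mpoly"
  shows "msubst f ` mpolys_over X = subalg hull (f ` X)"
proof
  have "f x \<in> msubst f ` mpolys_over X" if "x \<in> X" for x
    using that
    by (intro image_eqI[of _ _ "mvar x"])
       (simp_all only: msubst_mvar, simp add: mpolys_over_def mvar_def)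
  then show "subalg hull (f ` X) \<subseteq> msubst f ` mpolys_over X"
    by (intro hull_minimal subalg_image_msubst subalg_mpolys_over) auto
next
  have "msubst f p \<in> A"
    if A: "subalg A" "f ` X \<subseteq> A" and p: "p \<in> mpolys_over X" for A p
  proof -
    have c: "mconst c \<in> A" for c
      using A by (simp add: subalg_def)
    have add: "p + q \<in> A" and mult: "p * q \<in> A" if "p \<in> A" "q \<in> A" for p q
      using A that by (simp_all add: subalg_def)
    have one: "1 \<in> A" and zero: "0 \<in> A"
      using c[of 1] c[of 0] by simp_all
    have pow: "p ^ n \<in> A" if "p \<in> A" for p n
      using that by (induction n) (auto simp: one mult)
    have prod: "prod g B \<in> A" if "\<And>b. b \<in> B \<Longrightarrow> g b \<in> A" for g and B :: "'x set"
      using that by (induction B rule: infinite_finite_induct) (auto simp: one mult)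
    have sum: "sum g B \<in> A" if "\<And>b. b \<in> B \<Longrightarrow> g b \<in> A" for g and B :: "('x \<Rightarrow>\<^sub>0 nat) set"
      using that by (induction B rule: infinite_finite_induct) (auto simp: zero add)
    show ?thesis
      unfolding msubst_def
    proof (intro sum mult c prod pow)
      fix m x
      assume "m \<in> Poly_Mapping.keys p" "x \<in> Poly_Mapping.keys m"
      then show "f x \<in> A"
        using A(2) p by (auto simp: mpolys_over_def)
    qed
  qed
  then show "msubst f ` mpolys_over X \<subseteq> subalg hull (f ` X)"
    by (auto simp: hull_def)
qed

text \<open>The image of \<open>cut_hom\<close> is the subalgebra generated by the cut monomials.\<close>

theorem carrier_toric_ring: "carrier (toric_ring G) = subalg hull (cut_monomials G)"
  by (simp add: toric_ring_def mring_def cut_hom_def msubst_image_eq_hull cut_monomials_def)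

lemma cut_edges_partition:
  assumes "finite_simple_graph G" "A \<inter> B = {}" "A \<union> B = verts G"
  shows "cut_edges G {A, B} = {e \<in> edges G. card (A \<inter> e) = 1}"
proof -
  have "card (A \<inter> e) = 1 \<longleftrightarrow> card (B \<inter> e) = 1" if "e \<in> edges G" for e
  proof -
    have e: "e \<subseteq> verts G" "card e = 2" "finite e"
      using assms(1) that
      by (auto simp: finite_simple_graph_def intro: finite_subset)
    have "e = (A \<inter> e) \<union> (B \<inter> e)"
      using assms(3) e by blast
    moreover have "card ((A \<inter> e) \<union> (B \<inter> e)) = card (A \<inter> e) + card (B \<inter> e)"
      using assms(2) e by (intro card_Un_disjoint) auto
    ultimately have "card e = card (A \<inter> e) + card (B \<inter> e)"
      by simp
    with e show ?thesis
      by linarith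
  qed
  then show ?thesis
    by (auto simp: cut_edges_def)
qed

lemma prod_mvar_eq_single:
  assumes "finite E"
  shows "(\<Prod>e \<in> E. mvar (g e)) =
    Poly_Mapping.single (\<Sum>e \<in> E. Poly_Mapping.single (g e) 1) (1 :: 'k::comm_ring_1)"
  using assms by induction (simp_all add: mvar_def mult_single)

lemma homogeneous_cut_monomial:
  assumes "finite_simple_graph G"
  shows "homogeneous s_degree 1 (cut_monomial G P)"
proof -
  have "edges G \<subseteq> Pow (verts G)" "finite (verts G)"
    using assms by (auto simp: finite_simple_graph_def)
  then have "finite (cut_edges G P)"
    by (auto simp: cut_edges_def intro: finite_subset)
  then show ?thesis
    by (simp add: cut_monomial_def prod_mvar_eq_single homogeneous_def)
       (simp add: mvar_def mult_single s_degree_def lookup_add lookup_sum lookup_single)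
qed

end

theory Submission
  imports Defs
begin

text \<open>
  A toric ring is the monoid algebra of the monoid \<open>M\<close> spanned by the exponents of its
  generators, so ideals generated by monomials are determined by the exponents that they contain.
  This makes strong Koszulness a property of \<open>M\<close>: every common multiple of two distinct
  generators is a multiple of a common multiple of degree 2. Gluing two graphs at a vertex
  gives the Segre product: the cuts of the sum are the pairs of cuts, so its monoid
  is the fibre product of the two monoids over the degree. A common multiple of degree 2 can
  therefore be found in each coordinate separately; in a coordinate where the two generators
  agree one multiplies their common value by any generator dividing the cofactor.
\<close>

section \<open>Monoid algebras\<close>

text \<open>The submonoid generated by \<open>A\<close>. Adding one generator at a time lets case
  analysis extract a generator from every nonzero element.\<close>

inductive_set nat_span :: "'a::comm_monoid_add set \<Rightarrow> 'a set" for A where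
  zero: "0 \<in> nat_span A"
| add: "a \<in> A \<Longrightarrow> m \<in> nat_span A \<Longrightarrow> a + m \<in> nat_span A"

lemma nat_span_base: "a \<in> A \<Longrightarrow> a \<in> nat_span A"
  using nat_span.add[OF _ nat_span.zero, of a A] by simp

lemma nat_span_closed:
  assumes "m \<in> nat_span A" "n \<in> nat_span A"
  shows "m + n \<in> nat_span A"
  using assms by (induction rule: nat_span.induct) (auto simp: add.assoc intro: nat_span.add)

text \<open>The span of the monomials with exponent in \<open>S\<close>: a monoid algebra if
  \<open>S\<close> is a submonoid, a monomial ideal if \<open>S\<close> is a monoid ideal. One
  notation thus serves rings and ideals.\<close>

definition keys_in :: "('x \<Rightarrow>\<^sub>0 nat) set \<Rightarrow> ('x, 'k::comm_ring_1) mpoly set"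
  where "keys_in S = {p. Poly_Mapping.keys p \<subseteq> S}"

lemma keys_in_add: "p \<in> keys_in S \<Longrightarrow> q \<in> keys_in S \<Longrightarrow> p + q \<in> keys_in S"
  using keys_add[of p q] unfolding keys_in_def by blast

lemma keys_in_mult:
  assumes "p \<in> keys_in S" "q \<in> keys_in T" "\<And>m n. m \<in> S \<Longrightarrow> n \<in> T \<Longrightarrow> m + n \<in> U"
  shows "p * q \<in> keys_in U"
  using keys_mult[of p q] assms unfolding keys_in_def by blast

lemma single_in_keys_in [simp]:
  "Poly_Mapping.single m 1 \<in> (keys_in S :: ('x, 'k::comm_ring_1) mpoly set) \<longleftrightarrow> m \<in> S"
  by (simp add: keys_in_def)

lemma mconst_times_single: "mconst c * Poly_Mapping.single m 1 = Poly_Mapping.single m c"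
  by (simp add: mconst_def mult_single)

lemma subalg_keys_in: "subalg (keys_in (nat_span A))"
  unfolding subalg_def
  by (auto intro: keys_in_add keys_in_mult nat_span_closed)
     (simp add: keys_in_def mconst_def nat_span.zero)

text \<open>A polynomial is the finite sum of its terms. Putting the coefficient \<open>c\<close>
  into \<open>single\<close> lets the same argument serve subalgebras and ideals.\<close>

lemma keys_in_subset:
  fixes J :: "('x, 'k::comm_ring_1) mpoly set"
  assumes zero: "0 \<in> J"
    and add: "\<And>p q. p \<in> J \<Longrightarrow> q \<in> J \<Longrightarrow> p + q \<in> J"
    and single: "\<And>m c. m \<in> S \<Longrightarrow> Poly_Mapping.single m c \<in> J"
  shows "keys_in S \<subseteq> J"
proof
  fix p :: "('x, 'k) mpoly" assume p: "p \<in> keys_in S"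
  have sum: "sum g B \<in> J" if "\<And>b. b \<in> B \<Longrightarrow> g b \<in> J" for g and B :: "('x \<Rightarrow>\<^sub>0 nat) set"
    using that by (induction B rule: infinite_finite_induct) (auto simp: zero add)
  have "(\<Sum>m \<in> Poly_Mapping.keys p. Poly_Mapping.single m (Poly_Mapping.lookup p m)) \<in> J"
    using p by (intro sum single) (auto simp: keys_in_def)
  then show "p \<in> J"
    using mpoly_expand[of p] by simp
qed

text \<open>Polynomials with exponents in the submonoid form a subalgebra containing the generators.
  Conversely, a subalgebra containing these contains every monomial of the span by induction on
  \<open>nat_span\<close>, then all scalar multiples and their sums.\<close>

lemma subalg_hull_monomials:
  "subalg hull ((\<lambda>a. Poly_Mapping.single a (1 :: 'k::comm_ring_1)) ` A) = keys_in (nat_span A)"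
    (is "subalg hull ?U = _")
proof
  show "subalg hull ?U \<subseteq> keys_in (nat_span A)"
    by (intro hull_minimal subalg_keys_in) (auto simp: nat_span_base)
  have "keys_in (nat_span A) \<subseteq> J" if J: "?U \<subseteq> J" "subalg J" for J
  proof (rule keys_in_subset)
    have const: "mconst c \<in> J" and mult: "p \<in> J \<Longrightarrow> q \<in> J \<Longrightarrow> p * q \<in> J" for c p q
      using J(2) by (auto simp: subalg_def)
    have one: "Poly_Mapping.single m 1 \<in> J" if "m \<in> nat_span A" for m
      using that
    proof induction
      case zero
      then show ?case using const[of 1] by (simp add: mconst_def)
    next
      case (add a m)
      then have "Poly_Mapping.single a 1 * Poly_Mapping.single m 1 \<in> J"
        using J(1) by (intro mult) auto
      then show ?case by (simp add: mult_single)
    qed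
    show "Poly_Mapping.single m c \<in> J" if "m \<in> nat_span A" for m c
      using mult[OF const[of c] one[OF that]] by (simp add: mconst_times_single)
    show "0 \<in> J" using const[of 0] by simp
    show "p + q \<in> J" if "p \<in> J" "q \<in> J" for p q
      using that J(2) by (auto simp: subalg_def)
  qed
  then show "keys_in (nat_span A) \<subseteq> subalg hull ?U"
    by (auto simp: hull_def)
qed

section \<open>Ideals spanned by monomials\<close>

lemma ideal_keys_in:
  fixes A :: "('x \<Rightarrow>\<^sub>0 nat) set"
  assumes "S \<subseteq> nat_span A" "\<And>m n. m \<in> S \<Longrightarrow> n \<in> nat_span A \<Longrightarrow> m + n \<in> S"
  shows "ideal (keys_in S) (mring (keys_in (nat_span A) :: ('x, 'k::comm_ring_1) mpoly set))"
proof -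
  let ?R = "mring (keys_in (nat_span A) :: ('x, 'k) mpoly set)"
  have cring: "cring ?R"
    by (rule cring_mring[OF subalg_keys_in])
  then interpret R: cring ?R .
  have left: "q * p \<in> keys_in S" if "p \<in> keys_in S" "q \<in> keys_in (nat_span A)"
    for p q :: "('x, 'k) mpoly"
    using that(2,1) by (rule keys_in_mult) (metis add.commute assms(2))
  have sub: "keys_in S \<subseteq> carrier ?R"
    using assms(1) by (auto simp: mring_def keys_in_def)
  show ?thesis
  proof (rule idealI)
    show "subgroup (keys_in S) (add_monoid ?R)"
    proof (rule R.add.subgroupI)
      show "\<ominus>\<^bsub>?R\<^esub> p \<in> keys_in S" if p: "p \<in> keys_in S" for p
      proof -
        \<comment> \<open>The inverse \<open>\<ominus>\<close> of the ring record is known only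
          through the ring axioms, so negation is reached as multiplication by the inverse of one,
          to which absorption applies.\<close>
        have "\<ominus>\<^bsub>?R\<^esub> \<one>\<^bsub>?R\<^esub> \<in> carrier ?R"
          by simp
        then have "(\<ominus>\<^bsub>?R\<^esub> \<one>\<^bsub>?R\<^esub>) \<otimes>\<^bsub>?R\<^esub> p \<in> keys_in S"
          using left[OF p] by (simp add: mring_def)
        then show ?thesis
          using p sub by (simp add: R.l_minus subset_iff)
      qed
      have "0 \<in> keys_in S"
        by (simp add: keys_in_def)
      then show "keys_in S \<noteq> ({} :: ('x, 'k) mpoly set)"
        by blast
    qed (use sub in \<open>auto simp: mring_def intro: keys_in_add\<close>)
  qed (use left cring in \<open>auto simp: mring_def mult.commute cring.axioms(1)\<close>)
qed

text \<open>Multiplying by the monomial shifts every exponent by \<open>a\<close>. Conversely, a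
  term with exponent \<open>a + n\<close> is the monomial times a term with exponent
  \<open>n\<close>, and ideals are closed under sums.\<close>

lemma PIdl_monomial:
  assumes "a \<in> nat_span A"
  shows "PIdl\<^bsub>mring (keys_in (nat_span A))\<^esub> (Poly_Mapping.single a (1 :: 'k::comm_ring_1)) =
    keys_in ((+) a ` nat_span A)" (is "PIdl\<^bsub>?R\<^esub> ?u = _")
proof -
  interpret R: cring ?R
    by (rule cring_mring[OF subalg_keys_in])
  have u: "?u \<in> carrier ?R"
    using assms by (simp add: mring_def)
  interpret I: ideal "PIdl\<^bsub>?R\<^esub> ?u" ?R
    using u by (rule R.cgenideal_ideal)
  show ?thesis
  proof
    have "q * ?u \<in> keys_in ((+) a ` nat_span A)" if "q \<in> keys_in (nat_span A)" for q
      by (rule keys_in_mult[OF that, of _ "{a}"]) (auto simp: add.commute)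
    then show "PIdl\<^bsub>?R\<^esub> ?u \<subseteq> keys_in ((+) a ` nat_span A)"
      by (auto simp: cgenideal_def mring_def)
    show "keys_in ((+) a ` nat_span A) \<subseteq> PIdl\<^bsub>?R\<^esub> ?u"
    proof (rule keys_in_subset)
      show "0 \<in> PIdl\<^bsub>?R\<^esub> ?u"
        using I.zero_closed by (simp add: mring_def)
      show "p + q \<in> PIdl\<^bsub>?R\<^esub> ?u" if "p \<in> PIdl\<^bsub>?R\<^esub> ?u" "q \<in> PIdl\<^bsub>?R\<^esub> ?u" for p q
        using I.a_closed[OF that] by (simp add: mring_def)
      show "Poly_Mapping.single m c \<in> PIdl\<^bsub>?R\<^esub> ?u" if m: "m \<in> (+) a ` nat_span A" for m c
      proof -
        obtain n where n: "m = a + n" "n \<in> nat_span A"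
          using m by blast
        then have "Poly_Mapping.single m c = Poly_Mapping.single n c * ?u"
          by (simp add: mult_single add.commute)
        moreover have "Poly_Mapping.single n c \<in> keys_in (nat_span A)"
          using n by (simp add: keys_in_def)
        ultimately show ?thesis
          by (auto simp: cgenideal_def mring_def)
      qed
    qed
  qed
qed

text \<open>In an ideal spanned by monomials, homogeneous generators can be replaced by the
  monomials occurring in them, so generation in degree \<open>d\<close> becomes a divisibility
  condition on exponents. Here \<open>deg\<close> is an arbitrary function.\<close>

lemma generated_in_degree_keys_in:
  fixes A :: "('x \<Rightarrow>\<^sub>0 nat) set"
  assumes S: "S \<subseteq> nat_span A" "\<And>m n. m \<in> S \<Longrightarrow> n \<in> nat_span A \<Longrightarrow> m + n \<in> S"
  shows "generated_in_degree deg (mring (keys_in (nat_span A))) d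
      (keys_in S :: ('x, 'k::comm_ring_1) mpoly set) \<longleftrightarrow>
    (\<forall>w \<in> S. \<exists>z \<in> S. deg z = d \<and> (\<exists>m \<in> nat_span A. w = z + m))" (is "?L \<longleftrightarrow> ?Q")
proof -
  let ?R = "mring (keys_in (nat_span A) :: ('x, 'k) mpoly set)"
  interpret R: cring ?R
    by (rule cring_mring[OF subalg_keys_in])
  have carrier: "carrier ?R = keys_in (nat_span A)"
    by (simp add: mring_def)
  \<comment> \<open>The exponents divisible by a degree \<open>d\<close> element of
    \<open>S\<close>. Their span is an ideal; once it is seen to contain the generators
    \<open>B\<close>, minimality forces \<open>S\<close> into \<open>T\<close>.\<close>
  define T where "T = {z + m | z m. z \<in> S \<and> deg z = d \<and> m \<in> nat_span A}"
  show ?thesis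
  proof
    assume ?L
    then obtain B where B: "B \<subseteq> carrier ?R" "\<And>b. b \<in> B \<Longrightarrow> homogeneous deg d b"
        "keys_in S = Idl\<^bsub>?R\<^esub> B"
      unfolding generated_in_degree_def by blast
    have "ideal (keys_in T) ?R"
    proof (rule ideal_keys_in)
      show "T \<subseteq> nat_span A"
        using S(1) by (auto simp: T_def intro: nat_span_closed)
      show "m + n \<in> T" if mn: "m \<in> T" "n \<in> nat_span A" for m n
      proof -
        obtain z k where "m = z + k" "z \<in> S" "deg z = d" "k \<in> nat_span A"
          using mn(1) unfolding T_def by blast
        then have "m + n = z + (k + n)" "k + n \<in> nat_span A"
          using mn(2) by (simp_all add: add.assoc nat_span_closed)
        then show ?thesis
          unfolding T_def using \<open>z \<in> S\<close> \<open>deg z = d\<close> by blast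
      qed
    qed
    moreover have "B \<subseteq> keys_in T"
    proof
      fix b assume b: "b \<in> B"
      \<comment> \<open>Every term of \<open>b\<close> has its exponent in \<open>S\<close> and, by
        homogeneity, in degree \<open>d\<close>; the exponent lies in \<open>T\<close> with cofactor
        0.\<close>
      then have "b \<in> keys_in S"
        using B(1,3) R.genideal_self by blast
      then have "z \<in> S \<and> deg z = d" if "z \<in> Poly_Mapping.keys b" for z
        using B(2)[OF b] that by (auto simp: homogeneous_def keys_in_def)
      then have "z \<in> T" if "z \<in> Poly_Mapping.keys b" for z
        unfolding T_def using that nat_span.zero[of A]
        by (intro CollectI exI[of _ z] exI[of _ 0]) simp
      then show "b \<in> keys_in T"
        by (auto simp: keys_in_def)
    qed
    ultimately have "(keys_in S :: ('x, 'k) mpoly set) \<subseteq> keys_in T"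
      unfolding B(3) by (rule R.genideal_minimal)
    \<comment> \<open>Monomials with coefficient 1 recover the inclusion of exponent sets from that
      of the ideals.\<close>
    then have "w \<in> T" if "w \<in> S" for w
      using that single_in_keys_in[of w S, where 'k = 'k] single_in_keys_in[of w T, where 'k = 'k]
      by blast
    then show ?Q
      unfolding T_def by blast
  next
    assume Q: ?Q
    define B where "B = (\<lambda>z. Poly_Mapping.single z (1 :: 'k)) ` {z \<in> S. deg z = d}"
    have B: "B \<subseteq> carrier ?R"
      using S(1) by (auto simp: B_def carrier)
    interpret I: ideal "Idl\<^bsub>?R\<^esub> B" ?R
      using B by (rule R.genideal_ideal)
    have "keys_in S = Idl\<^bsub>?R\<^esub> B"
    proof
      show "Idl\<^bsub>?R\<^esub> B \<subseteq> keys_in S"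
        by (intro R.genideal_minimal ideal_keys_in S) (auto simp: B_def)
      show "keys_in S \<subseteq> Idl\<^bsub>?R\<^esub> B"
      proof (rule keys_in_subset)
        show "0 \<in> Idl\<^bsub>?R\<^esub> B"
          using I.zero_closed by (simp add: mring_def)
        show "p + q \<in> Idl\<^bsub>?R\<^esub> B" if "p \<in> Idl\<^bsub>?R\<^esub> B" "q \<in> Idl\<^bsub>?R\<^esub> B" for p q
          using I.a_closed[OF that] by (simp add: mring_def)
        show "Poly_Mapping.single w c \<in> Idl\<^bsub>?R\<^esub> B" if w: "w \<in> S" for w c
        proof -
          obtain z m where zm: "z \<in> S" "deg z = d" "m \<in> nat_span A" "w = z + m"
            using Q w by blast
          have "Poly_Mapping.single z 1 \<in> Idl\<^bsub>?R\<^esub> B"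
            using R.genideal_self[OF B] zm by (auto simp: B_def)
          moreover have "Poly_Mapping.single m c \<in> carrier ?R"
            unfolding carrier using zm by (simp add: keys_in_def)
          ultimately have "Poly_Mapping.single z 1 \<otimes>\<^bsub>?R\<^esub> Poly_Mapping.single m c \<in> Idl\<^bsub>?R\<^esub> B"
            by (rule I.I_r_closed)
          then show ?thesis
            by (simp add: mring_def mult_single zm)
        qed
      qed
    qed
    moreover have "\<forall>b \<in> B. homogeneous deg d b"
      by (auto simp: B_def homogeneous_def)
    ultimately show ?L
      unfolding generated_in_degree_def using B by (intro exI[of _ B] conjI)
  qed
qed

section \<open>Strong Koszulness in terms of exponents\<close>

definition strongly_Koszul_monoid :: "('a::comm_monoid_add \<Rightarrow> nat) \<Rightarrow> 'a set \<Rightarrow> bool"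
  where "strongly_Koszul_monoid deg A \<longleftrightarrow>
    (\<forall>a \<in> A. \<forall>b \<in> A. a \<noteq> b \<longrightarrow>
      (\<forall>w \<in> (+) a ` nat_span A \<inter> (+) b ` nat_span A.
        \<exists>z \<in> (+) a ` nat_span A \<inter> (+) b ` nat_span A.
          deg z = 2 \<and> (\<exists>m \<in> nat_span A. w = z + m)))"

text \<open>Because \<open>keys_in\<close> commutes with intersections, two principal monomial
  ideals meet in the span of the common multiples, and the criterion for generation in degree 2
  applies. The monoid side does not involve the coefficient ring.\<close>

lemma strongly_Koszul_iff_monoid:
  fixes A :: "('x \<Rightarrow>\<^sub>0 nat) set"
  shows "strongly_Koszul deg (mring (keys_in (nat_span A)))
      ((\<lambda>a. Poly_Mapping.single a (1 :: 'k::comm_ring_1)) ` A) \<longleftrightarrow>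
    strongly_Koszul_monoid deg A"
proof -
  let ?R = "mring (keys_in (nat_span A) :: ('x, 'k) mpoly set)"
  let ?u = "\<lambda>a. Poly_Mapping.single a (1 :: 'k)"
  \<comment> \<open>The ring condition ranges over distinct monomials, the monoid condition over
    distinct exponents; these agree because \<open>1 \<noteq> 0\<close>.\<close>
  have inj: "?u a = ?u b \<longleftrightarrow> a = b" for a b
    by (metis keys_single one_neq_zero the_elem_eq)
  have generated: "generated_in_degree deg ?R 2 (PIdl\<^bsub>?R\<^esub> ?u a \<inter> PIdl\<^bsub>?R\<^esub> ?u b) \<longleftrightarrow>
      (\<forall>w \<in> (+) a ` nat_span A \<inter> (+) b ` nat_span A.
        \<exists>z \<in> (+) a ` nat_span A \<inter> (+) b ` nat_span A.
          deg z = 2 \<and> (\<exists>m \<in> nat_span A. w = z + m))" if ab: "a \<in> A" "b \<in> A" for a b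
  proof -
    let ?S = "(+) a ` nat_span A \<inter> (+) b ` nat_span A"
    have eq: "PIdl\<^bsub>?R\<^esub> ?u a \<inter> PIdl\<^bsub>?R\<^esub> ?u b = keys_in ?S"
      unfolding PIdl_monomial[OF nat_span_base[OF ab(1)]] PIdl_monomial[OF nat_span_base[OF ab(2)]]
      by (auto simp: keys_in_def)
    show ?thesis
      unfolding eq
    proof (rule generated_in_degree_keys_in)
      show "?S \<subseteq> nat_span A"
        using ab by (auto intro: nat_span.add)
      have "m + n \<in> (+) c ` nat_span A" if "m \<in> (+) c ` nat_span A" "n \<in> nat_span A" for m n c
        using that by (auto simp: add.assoc intro: nat_span_closed)
      then show "m + n \<in> ?S" if "m \<in> ?S" "n \<in> nat_span A" for m n
        using that by blast
    qed
  qed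
  have "strongly_Koszul deg ?R (?u ` A) \<longleftrightarrow> (\<forall>a \<in> A. \<forall>b \<in> A. ?u a \<noteq> ?u b \<longrightarrow>
      generated_in_degree deg ?R 2 (PIdl\<^bsub>?R\<^esub> ?u a \<inter> PIdl\<^bsub>?R\<^esub> ?u b))"
    unfolding strongly_Koszul_def by (simp only: ball_simps)
  also have "\<dots> \<longleftrightarrow> strongly_Koszul_monoid deg A"
    unfolding strongly_Koszul_monoid_def inj
    by (intro ball_cong refl imp_cong[OF refl] generated)
  finally show ?thesis .
qed


section \<open>Segre products\<close>

text \<open>Fibre product over the degree, in abstract form: by \<open>gens\<close> the coordinate
  pairs of generators are exactly all pairs of generators, and by \<open>inj\<close> the two
  coordinates determine an element of the monoid.\<close>

locale Segre_product =
  fixes A :: "'a::cancel_comm_monoid_add set" and A1 :: "'b::cancel_comm_monoid_add set"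
    and A2 :: "'c::cancel_comm_monoid_add set"
    and r1 :: "'a \<Rightarrow> 'b" and r2 :: "'a \<Rightarrow> 'c"
    and deg :: "'a \<Rightarrow> nat" and deg1 :: "'b \<Rightarrow> nat" and deg2 :: "'c \<Rightarrow> nat"
  assumes hom_add: "deg (x + y) = deg x + deg y" "deg1 (x1 + y1) = deg1 x1 + deg1 y1"
      "deg2 (x2 + y2) = deg2 x2 + deg2 y2" "r1 (x + y) = r1 x + r1 y" "r2 (x + y) = r2 x + r2 y"
    and deg_gen: "a \<in> A \<Longrightarrow> deg a = 1" "a1 \<in> A1 \<Longrightarrow> deg1 a1 = 1" "a2 \<in> A2 \<Longrightarrow> deg2 a2 = 1"
    and gens: "(\<lambda>a. (r1 a, r2 a)) ` A = A1 \<times> A2"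
    and inj: "x \<in> nat_span A \<Longrightarrow> y \<in> nat_span A \<Longrightarrow> r1 x = r1 y \<Longrightarrow> r2 x = r2 y \<Longrightarrow> x = y"
begin

text \<open>Additivity gives \<open>f 0 = f 0 + f 0\<close>, and cancellation does the rest.\<close>

lemma hom_zero: "deg 0 = 0" "deg1 0 = 0" "deg2 0 = 0" "r1 0 = 0" "r2 0 = 0"
  using hom_add(1)[of 0 0] hom_add(2)[of 0 0] hom_add(3)[of 0 0] hom_add(4)[of 0 0] hom_add(5)[of 0 0]
  by simp_all

lemma r_gen: "a \<in> A \<Longrightarrow> r1 a \<in> A1" "a \<in> A \<Longrightarrow> r2 a \<in> A2"
  using gens by (auto simp: set_eq_iff image_iff)

lemma span_r:
  assumes "m \<in> nat_span A"
  shows "r1 m \<in> nat_span A1 \<and> r2 m \<in> nat_span A2 \<and> deg1 (r1 m) = deg m \<and> deg2 (r2 m) = deg m"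
  using assms
  by induction (auto simp: hom_zero hom_add deg_gen r_gen intro: nat_span.intros)

text \<open>One generator is removed from both coordinates simultaneously. The remainders again have
  equal degrees, and \<open>gens\<close> lifts each pair of generators.\<close>

lemma fibre_product:
  assumes "m1 \<in> nat_span A1" "m2 \<in> nat_span A2" "deg1 m1 = deg2 m2"
  obtains m where "m \<in> nat_span A" "r1 m = m1" "r2 m = m2"
proof -
  have "\<exists>m \<in> nat_span A. r1 m = m1 \<and> r2 m = m2"
    using assms
  proof (induction arbitrary: m2 rule: nat_span.induct)
    case zero
    \<comment> \<open>All generators have degree 1, so 0 is the only element of degree 0 in the
      span.\<close>
    from zero(1,2) have "m2 = 0"
      by cases (auto simp: hom_zero hom_add deg_gen)
    then show ?case
      using nat_span.zero hom_zero by blast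
  next
    case (add a1 n1)
    note a1 = add.hyps(1)
    from add.prems show ?case
    proof cases
      \<comment> \<open>Contradictory, since \<open>a1 + n1\<close> has positive degree.\<close>
      case zero
      then show ?thesis
        using add.prems a1 by (simp add: hom_zero hom_add deg_gen)
    next
      case (add a2 n2)
      then have "deg1 n1 = deg2 n2"
        using \<open>deg1 (a1 + n1) = deg2 m2\<close> a1
        by (simp add: hom_add deg_gen)
      then obtain n where n: "n \<in> nat_span A" "r1 n = n1" "r2 n = n2"
        using \<open>\<And>m2. _ \<Longrightarrow> _ \<Longrightarrow> \<exists>m \<in> nat_span A. r1 m = n1 \<and> r2 m = m2\<close> add by blast
      have "(a1, a2) \<in> (\<lambda>a. (r1 a, r2 a)) ` A"
        using gens a1 add by simp
      then obtain a where "a \<in> A" "r1 a = a1" "r2 a = a2"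
        by auto
      then show ?thesis
        using n add by (intro bexI[of _ "a + n"])
          (auto simp: hom_add intro: nat_span.add)
    qed
  qed
  then show thesis
    using that by blast
qed

end

text \<open>
  One coordinate of the Segre product. For \<open>a = b\<close> the common multiple of degree 2 is not
  provided by the hypothesis, and the lower bound on the degree of \<open>a + x\<close> replaces it.
\<close>

lemma strongly_Koszul_monoid_lift:
  fixes A :: "'a::cancel_comm_monoid_add set"
  assumes "strongly_Koszul_monoid deg A" "\<And>x y. deg (x + y) = deg x + deg y"
    "\<And>a. a \<in> A \<Longrightarrow> deg a = 1" "a \<in> A" "b \<in> A" "x \<in> nat_span A" "y \<in> nat_span A"
    "a + x = b + y" "deg x \<ge> 1"
  obtains p q m where "p \<in> nat_span A" "q \<in> nat_span A" "m \<in> nat_span A"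
    "a + p = b + q" "x = p + m" "deg p = 1" "deg q = 1"
proof (cases "a = b")
  case True
  have "deg 0 = 0"
    using assms(2)[of 0 0] by simp
  with \<open>x \<in> nat_span A\<close> \<open>deg x \<ge> 1\<close> obtain g m where "g \<in> A" "m \<in> nat_span A" "x = g + m"
    by cases auto
  then show thesis
    using that[of g g m] True assms(3) by (simp add: nat_span_base)
next
  case False
  have "a + x \<in> (+) a ` nat_span A \<inter> (+) b ` nat_span A"
    using assms(6-8) by (metis IntI image_eqI)
  then obtain z m where z: "z \<in> (+) a ` nat_span A \<inter> (+) b ` nat_span A" "deg z = 2"
      "m \<in> nat_span A" "a + x = z + m"
    using assms(1,4,5) False unfolding strongly_Koszul_monoid_def by meson
  then obtain p q where "p \<in> nat_span A" "q \<in> nat_span A" "z = a + p" "z = b + q"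
    by blast
  \<comment> \<open>Cancelling \<open>a\<close> gives \<open>x = p + m\<close>. As \<open>z\<close>
    has degree 2 and generators have degree 1, \<open>p\<close> and \<open>q\<close> have degree
    1.\<close>
  with z show thesis
    using that[of p q m] assms(2)[of a p] assms(2)[of b q] assms(3)[OF assms(4)] assms(3)[OF assms(5)]
    by (simp add: add.assoc)
qed

text \<open>The two coordinates of each of \<open>p\<close>, \<open>q\<close> and \<open>m\<close>
  have equal degrees, so the fibre product recombines them, and \<open>inj\<close> transfers the
  coordinate equations back to the monoid.\<close>

lemma (in Segre_product) strongly_Koszul_monoid_Segre:
  assumes "strongly_Koszul_monoid deg1 A1" "strongly_Koszul_monoid deg2 A2"
  shows "strongly_Koszul_monoid deg A"
  unfolding strongly_Koszul_monoid_def
proof (intro ballI impI)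
  fix a b w
  assume ab: "a \<in> A" "b \<in> A" "a \<noteq> b"
    and "w \<in> (+) a ` nat_span A \<inter> (+) b ` nat_span A"
  then obtain x y where xy: "w = a + x" "a + x = b + y" "x \<in> nat_span A" "y \<in> nat_span A"
    by blast
  have "deg x = deg y"
    using arg_cong[OF xy(2), of deg] ab by (simp add: hom_add deg_gen)
  \<comment> \<open>Degree 0 would give \<open>x = y = 0\<close> and hence \<open>a = b\<close>.
    Positivity is what the lift requires in a coordinate where \<open>a\<close> and \<open>b\<close>
    have the same image.\<close>
  have "deg x \<noteq> 0"
  proof
    assume "deg x = 0"
    have "n = 0" if "n \<in> nat_span A" "deg n = 0" for n
      using that by cases (auto simp: hom_add deg_gen)
    then show False
      using xy(2-4) ab(3) \<open>deg x = 0\<close> \<open>deg x = deg y\<close> by (metis add.right_neutral)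
  qed
  then have deg: "deg1 (r1 x) \<ge> 1" "deg2 (r2 x) \<ge> 1"
    using span_r[OF xy(3)] by simp_all
  have eq: "r1 a + r1 x = r1 b + r1 y" "r2 a + r2 x = r2 b + r2 y"
    using arg_cong[OF xy(2), of r1] arg_cong[OF xy(2), of r2] by (simp_all add: hom_add)
  obtain p1 q1 m1 where 1: "p1 \<in> nat_span A1" "q1 \<in> nat_span A1" "m1 \<in> nat_span A1"
      "r1 a + p1 = r1 b + q1" "r1 x = p1 + m1" "deg1 p1 = 1" "deg1 q1 = 1"
    using strongly_Koszul_monoid_lift[OF assms(1) hom_add(2) deg_gen(2) _ _ _ _ eq(1) deg(1)]
      span_r xy r_gen ab by metis
  obtain p2 q2 m2 where 2: "p2 \<in> nat_span A2" "q2 \<in> nat_span A2" "m2 \<in> nat_span A2"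
      "r2 a + p2 = r2 b + q2" "r2 x = p2 + m2" "deg2 p2 = 1" "deg2 q2 = 1"
    using strongly_Koszul_monoid_lift[OF assms(2) hom_add(3) deg_gen(3) _ _ _ _ eq(2) deg(2)]
      span_r xy r_gen ab by metis
  obtain p where p: "p \<in> nat_span A" "r1 p = p1" "r2 p = p2"
    using fibre_product[of p1 p2] 1 2 by metis
  obtain q where q: "q \<in> nat_span A" "r1 q = q1" "r2 q = q2"
    using fibre_product[of q1 q2] 1 2 by metis
  \<comment> \<open>Both equal \<open>deg x - 1\<close>.\<close>
  have "deg1 m1 = deg2 m2"
    using span_r[OF xy(3)] 1 2 by (simp add: hom_add)
  then obtain m where m: "m \<in> nat_span A" "r1 m = m1" "r2 m = m2"
    using fibre_product[of m1 m2] 1 2 by metis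
  have "a + p = b + q"
    by (rule inj) (simp_all add: hom_add p q 1 2 ab nat_span.add)
  moreover have "x = p + m"
    by (rule inj) (simp_all add: hom_add p m 1 2 xy nat_span_closed)
  moreover have "deg p = 1"
    using span_r[OF p(1)] p 1 by simp
  moreover have "a + p \<in> (+) a ` nat_span A \<inter> (+) b ` nat_span A"
    using \<open>a + p = b + q\<close> p(1) q(1) by (metis IntI image_eqI)
  ultimately show "\<exists>z \<in> (+) a ` nat_span A \<inter> (+) b ` nat_span A.
      deg z = 2 \<and> (\<exists>m \<in> nat_span A. w = z + m)"
    using ab(1) m(1) xy(1) by (metis add.assoc deg_gen(1) hom_add(1) one_add_one)
qed


section \<open>Cuts of a 0-sum\<close>

definition cut_exponent :: "'v graph \<Rightarrow> 'v set set \<Rightarrow> 'v cut_var \<Rightarrow>\<^sub>0 nat"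
  where "cut_exponent G P =
    Poly_Mapping.single Svar 1 + (\<Sum>e \<in> cut_edges G P. Poly_Mapping.single (Tvar e) 1)"

lemma finite_cut_edges:
  assumes "finite_simple_graph G"
  shows "finite (cut_edges G P)"
proof -
  have "edges G \<subseteq> Pow (verts G)" "finite (verts G)"
    using assms by (auto simp: finite_simple_graph_def)
  then show ?thesis
    by (auto simp: cut_edges_def intro: finite_subset)
qed

lemma cut_monomial_eq_single:
  assumes "finite_simple_graph G"
  shows "cut_monomial G P = Poly_Mapping.single (cut_exponent G P) (1 :: 'k::field)"
  unfolding cut_monomial_def prod_mvar_eq_single[OF finite_cut_edges[OF assms]] cut_exponent_def
  by (simp add: mvar_def mult_single)

lemma lookup_cut_exponent:
  assumes "finite_simple_graph G"
  shows "Poly_Mapping.lookup (cut_exponent G P) x =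
    (case x of Svar \<Rightarrow> 1 | Tvar e \<Rightarrow> if e \<in> cut_edges G P then 1 else 0)"
  using finite_cut_edges[OF assms, of P]
  by (auto simp: cut_exponent_def lookup_add lookup_sum lookup_single when_def sum.delta
      split: cut_var.split)

abbreviation cut_exponents :: "'v graph \<Rightarrow> ('v cut_var \<Rightarrow>\<^sub>0 nat) set"
  where "cut_exponents G \<equiv> cut_exponent G ` cut_partitions G"

lemma toric_strongly_Koszul_iff_monoid:
  assumes "finite_simple_graph G"
  shows "toric_strongly_Koszul TYPE('k::field) G \<longleftrightarrow>
    strongly_Koszul_monoid s_degree (cut_exponents G)"
proof -
  have U: "cut_monomials G = (\<lambda>a. Poly_Mapping.single a (1 :: 'k)) ` cut_exponents G"
    by (auto simp: cut_monomials_def cut_monomial_eq_single[OF assms])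
  \<comment> \<open>The toric ring is determined by its carrier, so the hull description of the
    carrier rewrites the whole ring.\<close>
  have "(toric_ring G :: ('a cut_var, 'k) mpoly ring) = mring (carrier (toric_ring G))"
    by (simp add: toric_ring_def mring_def)
  then have "(toric_ring G :: ('a cut_var, 'k) mpoly ring) = mring (keys_in (nat_span (cut_exponents G)))"
    by (simp add: carrier_toric_ring U subalg_hull_monomials)
  then show ?thesis
    unfolding toric_strongly_Koszul_def U by (simp add: strongly_Koszul_iff_monoid)
qed

section \<open>Restricting exponents and cuts to a subgraph\<close>

definition restrict_exponent :: "'x set \<Rightarrow> ('x \<Rightarrow>\<^sub>0 nat) \<Rightarrow> 'x \<Rightarrow>\<^sub>0 nat"
  where "restrict_exponent X = Poly_Mapping.mapp (\<lambda>x n. if x \<in> X then n else 0)"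

lemma lookup_restrict_exponent:
  "Poly_Mapping.lookup (restrict_exponent X m) x = (if x \<in> X then Poly_Mapping.lookup m x else 0)"
  by (simp add: restrict_exponent_def lookup_mapp when_def in_keys_iff)

lemma restrict_exponent_add:
  "restrict_exponent X (m + n) = restrict_exponent X m + restrict_exponent X n"
  by (rule poly_mapping_eqI) (simp add: lookup_restrict_exponent lookup_add)

text \<open>\<open>Svar\<close> is included for every graph, so restricting exponents to
  \<open>cut_vars\<close> keeps the degree. These restrictions become the coordinate maps of the
  Segre product.\<close>

definition cut_vars :: "'v graph \<Rightarrow> 'v cut_var set"
  where "cut_vars G = insert Svar (Tvar ` edges G)"

text \<open>Makes an element of the span determined by its values on \<open>cut_vars G\<close>, as
  needed for injectivity of the pair of coordinate maps.\<close>

lemma keys_nat_span_cut_exponents: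
  assumes "finite_simple_graph G" "m \<in> nat_span (cut_exponents G)"
  shows "Poly_Mapping.keys m \<subseteq> cut_vars G"
  using assms(2)
proof induction
  case (add a m)
  have "Poly_Mapping.keys a \<subseteq> cut_vars G"
    using add(1) by (auto simp: cut_vars_def in_keys_iff lookup_cut_exponent[OF assms(1)]
        cut_edges_def split: cut_var.splits if_splits)
  then show ?case
    using keys_add[of a m] add by blast
qed simp

lemma restrict_cut_exponent:
  assumes "finite_simple_graph G" "finite_simple_graph H"
    and "cut_edges H Q = cut_edges G P \<inter> edges H"
  shows "restrict_exponent (cut_vars H) (cut_exponent G P) = cut_exponent H Q"
  using assms
  by (intro poly_mapping_eqI)
    (auto simp: lookup_restrict_exponent lookup_cut_exponent cut_vars_def split: cut_var.splits)

text \<open>An edge of \<open>H\<close> lies inside \<open>verts H\<close>, so intersecting a side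
  with \<open>verts H\<close> leaves its trace on the edge unchanged.\<close>

lemma cut_edges_subgraph:
  assumes "finite_simple_graph H" "edges H \<subseteq> edges G"
  shows "cut_edges H ((\<lambda>A. A \<inter> verts H) ` P) = cut_edges G P \<inter> edges H"
proof -
  have eq: "A \<inter> verts H \<inter> e = A \<inter> e" if "e \<in> edges H" for A e
    using assms(1) that unfolding finite_simple_graph_def by blast
  have "cut_edges H ((\<lambda>A. A \<inter> verts H) ` P) = {e \<in> edges H. \<exists>A \<in> P. card (A \<inter> verts H \<inter> e) = 1}"
    unfolding cut_edges_def by (simp only: bex_simps)
  also have "\<dots> = {e \<in> edges H. \<exists>A \<in> P. card (A \<inter> e) = 1}"
    by (intro Collect_cong conj_cong refl bex_cong) (simp only: eq)
  also have "\<dots> = cut_edges G P \<inter> edges H"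
    using assms(2) unfolding cut_edges_def by blast
  finally show ?thesis .
qed

lemma cut_partitions_subgraph:
  assumes "P \<in> cut_partitions G" "verts H \<subseteq> verts G"
  shows "(\<lambda>A. A \<inter> verts H) ` P \<in> cut_partitions H"
proof -
  obtain A B where "P = {A, B}" "A \<inter> B = {}" "A \<union> B = verts G"
    using assms(1) unfolding cut_partitions_def by blast
  then have "(\<lambda>A. A \<inter> verts H) ` P = {A \<inter> verts H, B \<inter> verts H}"
      "A \<inter> verts H \<inter> (B \<inter> verts H) = {}" "A \<inter> verts H \<union> B \<inter> verts H = verts H"
    using assms(2) by auto
  then show ?thesis
    unfolding cut_partitions_def by blast
qed

section \<open>Gluing cuts at a vertex\<close>

lemma cut_partition_side:
  assumes "P \<in> cut_partitions G" "c \<in> verts G"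
  obtains A B where "P = {A, B}" "A \<inter> B = {}" "A \<union> B = verts G" "c \<in> A"
proof -
  obtain A B where AB: "P = {A, B}" "A \<inter> B = {}" "A \<union> B = verts G"
    using assms(1) unfolding cut_partitions_def by blast
  then have BA: "P = {B, A}" "B \<inter> A = {}" "B \<union> A = verts G"
    by blast+
  have "c \<in> A \<or> c \<in> B"
    using assms(2) AB(3) by blast
  then show thesis
    using that[OF AB] that[OF BA] by (rule disjE)
qed

text \<open>The sides are named so that \<open>c\<close> lies in \<open>A1\<close> and
  \<open>A2\<close>; the glued cut has sides \<open>A1 \<union> A2\<close> and
  \<open>B1 \<union> B2\<close>. These are disjoint and restrict correctly because the only common
  vertex is \<open>c\<close>, which lies in neither \<open>B1\<close> nor \<open>B2\<close>.\<close>

lemma glue_cut_partitions: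
  assumes "P1 \<in> cut_partitions G1" "P2 \<in> cut_partitions G2" "verts G1 \<inter> verts G2 = {c}"
  obtains P where "P \<in> cut_partitions (clique_sum G1 G2)"
    "(\<lambda>A. A \<inter> verts G1) ` P = P1" "(\<lambda>A. A \<inter> verts G2) ` P = P2"
proof -
  have c: "c \<in> verts G1" "c \<in> verts G2"
    and common: "\<And>x. x \<in> verts G1 \<Longrightarrow> x \<in> verts G2 \<Longrightarrow> x = c"
    using assms(3) by blast+
  obtain A1 B1 where 1: "P1 = {A1, B1}" "A1 \<inter> B1 = {}" "A1 \<union> B1 = verts G1" "c \<in> A1"
    by (rule cut_partition_side[OF assms(1) c(1)])
  obtain A2 B2 where 2: "P2 = {A2, B2}" "A2 \<inter> B2 = {}" "A2 \<union> B2 = verts G2" "c \<in> A2"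
    by (rule cut_partition_side[OF assms(2) c(2)])
  have "(A1 \<union> A2) \<inter> (B1 \<union> B2) = {}"
    using 1(2-4) 2(2-4) common by blast
  moreover have "A1 \<union> A2 \<union> (B1 \<union> B2) = verts (clique_sum G1 G2)"
    using 1(3) 2(3) by (auto simp: clique_sum_def)
  ultimately have "{A1 \<union> A2, B1 \<union> B2} \<in> cut_partitions (clique_sum G1 G2)"
    unfolding cut_partitions_def by blast
  moreover have "(A1 \<union> A2) \<inter> verts G1 = A1" "(B1 \<union> B2) \<inter> verts G1 = B1"
      "(A1 \<union> A2) \<inter> verts G2 = A2" "(B1 \<union> B2) \<inter> verts G2 = B2"
    using 1(2-4) 2(2-4) common by blast+
  ultimately show thesis
    using that[of "{A1 \<union> A2, B1 \<union> B2}"] 1(1) 2(1) by simp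
qed

text \<open>Restriction sends a cut of the sum to a pair of cuts, and gluing at \<open>c\<close>
  shows that every pair arises.\<close>

lemma Segre_product_0_sum:
  fixes G1 G2 :: "'v graph"
  assumes "finite_simple_graph G1" "finite_simple_graph G2" "verts G1 \<inter> verts G2 = {c}"
  shows "Segre_product (cut_exponents (clique_sum G1 G2)) (cut_exponents G1) (cut_exponents G2)
    (restrict_exponent (cut_vars G1)) (restrict_exponent (cut_vars G2))
    s_degree s_degree s_degree"
proof -
  let ?G = "clique_sum G1 G2"
  let ?r1 = "restrict_exponent (cut_vars G1)" and ?r2 = "restrict_exponent (cut_vars G2)"
  let ?p1 = "\<lambda>P. (\<lambda>A. A \<inter> verts G1) ` P" and ?p2 = "\<lambda>P. (\<lambda>A. A \<inter> verts G2) ` P"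
  have fsg: "finite_simple_graph ?G"
    by (rule finite_simple_graph_clique_sum[OF assms(1,2)])
  have r: "?r1 (cut_exponent ?G P) = cut_exponent G1 (?p1 P)"
      "?r2 (cut_exponent ?G P) = cut_exponent G2 (?p2 P)" for P
    using assms fsg by (auto intro!: restrict_cut_exponent cut_edges_subgraph simp: clique_sum_def)
  have p: "?p1 P \<in> cut_partitions G1" "?p2 P \<in> cut_partitions G2"
    if "P \<in> cut_partitions ?G" for P
    using that by (auto intro!: cut_partitions_subgraph[of P ?G] simp: clique_sum_def)
  show ?thesis
  proof
    show "(\<lambda>a. (?r1 a, ?r2 a)) ` cut_exponents ?G = cut_exponents G1 \<times> cut_exponents G2"
    proof
      show "(\<lambda>a. (?r1 a, ?r2 a)) ` cut_exponents ?G \<subseteq> cut_exponents G1 \<times> cut_exponents G2"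
        using p by (auto simp: r)
      have "(cut_exponent G1 P1, cut_exponent G2 P2) \<in> (\<lambda>a. (?r1 a, ?r2 a)) ` cut_exponents ?G"
        if P12: "P1 \<in> cut_partitions G1" "P2 \<in> cut_partitions G2" for P1 P2
      proof -
        obtain P where "P \<in> cut_partitions ?G" "?p1 P = P1" "?p2 P = P2"
          using glue_cut_partitions[OF P12 assms(3)] .
        then show ?thesis
          by (intro image_eqI[of _ _ "cut_exponent ?G P"]) (auto simp: r)
      qed
      then show "cut_exponents G1 \<times> cut_exponents G2 \<subseteq> (\<lambda>a. (?r1 a, ?r2 a)) ` cut_exponents ?G"
        by blast
    qed
    show "x = y" if "x \<in> nat_span (cut_exponents ?G)" "y \<in> nat_span (cut_exponents ?G)"
      "?r1 x = ?r1 y" "?r2 x = ?r2 y" for x y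
    proof (rule poly_mapping_eqI)
      fix v
      \<comment> \<open>Every edge of the sum is an edge of one of the graphs, so the two
        restrictions together see all its variables; at any other variable both exponents
        vanish.\<close>
      consider "v \<in> cut_vars G1" | "v \<in> cut_vars G2" | "v \<notin> cut_vars ?G"
        by (auto simp: cut_vars_def clique_sum_def)
      then show "Poly_Mapping.lookup x v = Poly_Mapping.lookup y v"
      proof cases
        case 1
        then show ?thesis
          using arg_cong[OF that(3), of "\<lambda>m. Poly_Mapping.lookup m v"]
          by (simp add: lookup_restrict_exponent)
      next
        case 2
        then show ?thesis
          using arg_cong[OF that(4), of "\<lambda>m. Poly_Mapping.lookup m v"]
          by (simp add: lookup_restrict_exponent)
      next
        case 3
        then show ?thesis
          using keys_nat_span_cut_exponents[OF fsg] that(1,2) by (metis in_keys_iff subsetD)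
      qed
    qed
  qed (auto simp: s_degree_def lookup_add restrict_exponent_add lookup_cut_exponent fsg assms)
qed

theorem proposition1p3:
  fixes G1 G2 G :: "'v graph"
  assumes "finite_simple_graph G1"
    and "finite_simple_graph G2"
    and "toric_strongly_Koszul TYPE('k::field) G1"
    and "toric_strongly_Koszul TYPE('k) G2"
    and "is_k_sum 0 G1 G2 G"
  shows "toric_strongly_Koszul TYPE('k) G"
proof -
  \<comment> \<open>A \<open>k\<close>-sum glues along \<open>k + 1\<close> vertices, so for
    \<open>k = 0\<close> exactly one vertex is shared.\<close>
  have G: "G = clique_sum G1 G2" and "card (verts G1 \<inter> verts G2) = 1"
    using assms(5) by (auto simp: is_k_sum_def)
  then obtain c where "verts G1 \<inter> verts G2 = {c}"
    by (auto simp: card_1_singleton_iff)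
  then interpret Segre_product "cut_exponents G" "cut_exponents G1" "cut_exponents G2"
      "restrict_exponent (cut_vars G1)" "restrict_exponent (cut_vars G2)"
      s_degree s_degree s_degree
    unfolding G by (rule Segre_product_0_sum[OF assms(1,2)])
  have "finite_simple_graph G"
    unfolding G by (rule finite_simple_graph_clique_sum[OF assms(1,2)])
  then show ?thesis
    using strongly_Koszul_monoid_Segre assms(1-4) by (simp add: toric_strongly_Koszul_iff_monoid)
qed

end
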